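(* (1) If $\kappa = \mathfrak{s} = \mathfrak{a}_*$ and $\mathrm{cf}([\mathfrak{s}]^{\aleph_0}, \subseteq) = \mathfrak{s}$, then there is a saturated MAD family. (2) If $\kappa = \mathfrak{s} = \mathfrak{a}_*$, $\mathbf{U}(\kappa) = \kappa$, and $J_* \subseteq [\omega]^{\aleph_0}$ is dense, then there is a saturated MAD family $\mathcal{A} \subseteq J_*$.
   Context: For a set or cardinal $X$, $[X]^{\aleph_0}$ is the set of countably infinite subsets of $X$, $[X]^{\le\aleph_0}$ the set of countable subsets, and $[X]^{\kappa}$ the set of subsets of cardinality $\kappa$. $\mathrm{cf}([\lambda]^{\aleph_0}, \subseteq)$ is the minimal cardinality of a $\subseteq$-cofinal subset of $[\lambda]^{\aleph_0}$. For $A,B\subseteq\omega$, $A \subseteq^* B$ means that $A \setminus B$ is finite; we then say that $B$ almost contains $A$. Two subsets of $\omega$ are almost disjoint if their intersection is finite. A family $\mathcal{A} \subseteq [\omega]^{\aleph_0}$ is AD if it is infinite and any two distinct members are almost disjoint. It is MAD if it is AD and $\subseteq$-maximal among AD families $\subseteq [\omega]^{\aleph_0}$. For $\mathcal{A} \subseteq [\omega]^{\aleph_0}$, $\mathrm{id}_{\mathcal{A}}$ is the ideal of subsets of $\omega$ generated by $\mathcal{A}$ together with the finite subsets of $\omega$, and $\mathrm{id}^+_{\mathcal{A}} = [\omega]^{\aleph_0} \setminus \mathrm{id}_{\mathcal{A}}$. A MAD family $\mathcal{A}$ is saturated if every $B \in \mathrm{id}^+_{\mathcal{A}}$ almost contains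 some member of $\mathcal{A}$. $J \subseteq [\omega]^{\aleph_0}$ is dense if for every $B \in [\omega]^{\aleph_0}$ there is $A \in J$ with $A \subseteq B$. $\mathfrak{s}$ is the splitting number: the minimal cardinality of a family $\mathcal{S} \subseteq [\omega]^{\aleph_0}$ such that there is no $B \in [\omega]^{\aleph_0}$ satisfying, for every $C \in \mathcal{S}$, $B \subseteq^* C$ or $B \subseteq^* \omega \setminus C$. $\mathfrak{a}_*$ is the minimal cardinal $\kappa$ such that there is a sequence $\langle A_\alpha : \alpha < \kappa + \omega\rangle$ (ordinal sum) of pairwise almost disjoint infinite subsets of $\omega$ for which there is no infinite $B \subseteq \omega$ that is almost disjoint to $A_\alpha$ for every $\alpha < \kappa$ while $B \cap A_{\kappa+n}$ is infinite for infinitely many $n<\omega$. For an infinite cardinal $\kappa$, $\mathbf{U}(\kappa) = \min\{|\mathcal{P}| : \mathcal{P} \subseteq [\kappa]^{\le \aleph_0}$ and for every $X \in [\kappa]^\kappa$ there is $u \in \mathcal{P}$ with $|X \cap u| \ge \aleph_0\}$. *)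

theory Defs
  imports Main "HOL.Hull" "HOL-Library.Countable_Set"
begin

unbundle cardinal_syntax

text \<open>
  Cardinals are relations with \<open>Card_order\<close>, considered up to \<open>=o\<close>; the set of ordinals below
  the cardinal \<open>\<kappa>\<close> is \<open>Field \<kappa>\<close>. The set \<open>\<omega>\<close> is the type \<open>nat\<close>.
\<close>

definition ctbl_inf_subsets :: "'a set \<Rightarrow> 'a set set"  (\<open>'[_']\<^sup>\<omega>\<close>) where
  "[X]\<^sup>\<omega> = {Y. Y \<subseteq> X \<and> countable Y \<and> infinite Y}"

definition ctbl_subsets :: "'a set \<Rightarrow> 'a set set" where
  "ctbl_subsets X = {Y. Y \<subseteq> X \<and> countable Y}"

definition subsets_of_card :: "'a set \<Rightarrow> 'b rel \<Rightarrow> 'a set set" where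
  "subsets_of_card X \<kappa> = {Y. Y \<subseteq> X \<and> |Y| =o \<kappa>}"

definition is_min_card :: "'a set set \<Rightarrow> 'b rel \<Rightarrow> bool" where
  "is_min_card \<F> \<kappa> \<longleftrightarrow> Card_order \<kappa> \<and> (\<exists>S\<in>\<F>. |S| =o \<kappa>) \<and> (\<forall>S\<in>\<F>. \<kappa> \<le>o |S| )"

definition almost_subset :: "nat set \<Rightarrow> nat set \<Rightarrow> bool"  (infix \<open>\<subseteq>*\<close> 50) where
  "A \<subseteq>* B \<longleftrightarrow> finite (A - B)"

definition almost_disjoint :: "nat set \<Rightarrow> nat set \<Rightarrow> bool" where
  "almost_disjoint A B \<longleftrightarrow> finite (A \<inter> B)"

definition AD :: "nat set set \<Rightarrow> bool" where
  "AD \<A> \<longleftrightarrow> \<A> \<subseteq> [UNIV]\<^sup>\<omega> \<and> infinite \<A> \<and> pairwise almost_disjoint \<A>"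

definition MAD :: "nat set set \<Rightarrow> bool" where
  "MAD \<A> \<longleftrightarrow> AD \<A> \<and> (\<forall>\<B>. AD \<B> \<and> \<A> \<subseteq> \<B> \<longrightarrow> \<B> = \<A>)"

text \<open>The improper ideal is allowed, so that the generated ideal exists for every family.\<close>

definition set_ideal :: "nat set set \<Rightarrow> bool" where
  "set_ideal I \<longleftrightarrow> {} \<in> I \<and> (\<forall>A\<in>I. \<forall>B. B \<subseteq> A \<longrightarrow> B \<in> I) \<and> (\<forall>A\<in>I. \<forall>B\<in>I. A \<union> B \<in> I)"

definition id_of :: "nat set set \<Rightarrow> nat set set" where
  "id_of \<A> = set_ideal hull (\<A> \<union> {F. finite F})"

definition id_plus :: "nat set set \<Rightarrow> nat set set" where
  "id_plus \<A> = [UNIV]\<^sup>\<omega> - id_of \<A>"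

definition saturated_MAD :: "nat set set \<Rightarrow> bool" where
  "saturated_MAD \<A> \<longleftrightarrow> MAD \<A> \<and> (\<forall>B\<in>id_plus \<A>. \<exists>A\<in>\<A>. A \<subseteq>* B)"

definition dense_family :: "nat set set \<Rightarrow> bool" where
  "dense_family J \<longleftrightarrow> J \<subseteq> [UNIV]\<^sup>\<omega> \<and> (\<forall>B\<in>[UNIV]\<^sup>\<omega>. \<exists>A\<in>J. A \<subseteq> B)"

definition splitting_family :: "nat set set \<Rightarrow> bool" where
  "splitting_family S \<longleftrightarrow> S \<subseteq> [UNIV]\<^sup>\<omega> \<and>
     \<not> (\<exists>B\<in>[UNIV]\<^sup>\<omega>. \<forall>C\<in>S. B \<subseteq>* C \<or> B \<subseteq>* - C)"

definition is_splitting_number :: "'a rel \<Rightarrow> bool" where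
  "is_splitting_number \<kappa> \<longleftrightarrow> is_min_card {S. splitting_family S} \<kappa>"

text \<open>
  A sequence indexed by the ordinal \<open>\<kappa> + \<omega>\<close> is a function on the disjoint sum
  \<open>Field \<kappa> <+> UNIV\<close>: \<open>Inl \<alpha>\<close> is the index \<open>\<alpha> < \<kappa>\<close>, and \<open>Inr n\<close> is the index \<open>\<kappa> + n\<close>.
\<close>

definition a_star_sequence :: "'a rel \<Rightarrow> ('a + nat \<Rightarrow> nat set) \<Rightarrow> bool" where
  "a_star_sequence \<kappa> A \<longleftrightarrow>
     (\<forall>i\<in>Field \<kappa> <+> UNIV. infinite (A i)) \<and>
     (\<forall>i\<in>Field \<kappa> <+> UNIV. \<forall>j\<in>Field \<kappa> <+> UNIV. i \<noteq> j \<longrightarrow> almost_disjoint (A i) (A j)) \<and>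
     \<not> (\<exists>B. infinite B \<and> (\<forall>\<alpha>\<in>Field \<kappa>. almost_disjoint B (A (Inl \<alpha>))) \<and>
            infinite {n. infinite (B \<inter> A (Inr n))})"

text \<open>
  In the minimality clause it suffices to compare with cardinals \<open>\<mu>\<close> on the same type as \<open>\<kappa>\<close>,
  since every cardinal below \<open>\<kappa>\<close> is isomorphic to one on a subset of \<open>Field \<kappa>\<close>.
\<close>

definition is_a_star :: "'a rel \<Rightarrow> bool" where
  "is_a_star \<kappa> \<longleftrightarrow> Card_order \<kappa> \<and> (\<exists>A. a_star_sequence \<kappa> A) \<and>
     (\<forall>\<mu> :: 'a rel. Card_order \<mu> \<and> (\<exists>A. a_star_sequence \<mu> A) \<longrightarrow> \<kappa> \<le>o \<mu>)"

text \<open>\<open>is_cf_ctbl lam \<mu>\<close> means cf([\<open>lam\<close>]\<open>\<^sup>\<omega>\<close>, \<open>\<subseteq>\<close>) = \<open>\<mu>\<close>, and \<open>is_U \<kappa> \<mu>\<close> means U(\<open>\<kappa>\<close>) = \<open>\<mu>\<close>.\<close>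

definition is_cf_ctbl :: "'a rel \<Rightarrow> 'b rel \<Rightarrow> bool" where
  "is_cf_ctbl lam \<mu> \<longleftrightarrow>
     is_min_card {P. P \<subseteq> [Field lam]\<^sup>\<omega> \<and> (\<forall>X\<in>[Field lam]\<^sup>\<omega>. \<exists>Y\<in>P. X \<subseteq> Y)} \<mu>"

definition is_U :: "'a rel \<Rightarrow> 'b rel \<Rightarrow> bool" where
  "is_U \<kappa> \<mu> \<longleftrightarrow>
     is_min_card {P. P \<subseteq> ctbl_subsets (Field \<kappa>) \<and>
                     (\<forall>X\<in>subsets_of_card (Field \<kappa>) \<kappa>. \<exists>u\<in>P. infinite (X \<inter> u))} \<mu>"

end

theory Submission
  imports Defs
begin

text \<open>
  Call a set positive for a family if it belongs to \<open>id_plus\<close> of that family. A saturated MAD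
  family is built by recursion along a well-ordering of all sets \<open>b\<close> of natural numbers, of length
  the continuum: if \<open>b\<close> is positive for the members chosen so far, a new member \<open>a \<subseteq> b\<close> is added
  that is almost disjoint from them and lies in the prescribed dense family \<open>J\<close>. In the end every
  positive set contains a member, which gives both maximality and saturation; the first part is
  the case that \<open>J\<close> consists of all infinite sets. The obstacle is that at a late stage there may
  be \<open>\<kappa>\<close> or more earlier members, while the minimality of \<open>\<aa>\<^sub>*\<close> only provides an infinite subset
  of \<open>b\<close> almost disjoint from fewer than \<open>\<kappa>\<close> given sets (\<open>a_star_extend\<close>). The splitting number
  is used to reduce the number of earlier members that matter.

  A sequence witnessing the value of \<open>\<aa>\<^sub>*\<close> yields an unbounded family of at most \<open>\<kappa>\<close> functions;
  combined with a splitting family of size \<open>\<kappa>\<close> it gives sets \<open>e \<xi>\<close>, for \<open>\<xi> < \<kappa>\<close>, such that any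
  countably many infinite sets are split simultaneously by one \<open>e \<xi>\<close>
  (\<open>omega_splitting_sequence\<close>). Consequently every positive set \<open>b\<close> is cut by some \<open>e \<xi>\<close> into
  two positive pieces. Let \<open>\<xi>\<close> be least with this property. For \<open>\<zeta> < \<xi>\<close> exactly one side of
  \<open>e \<zeta>\<close> meets \<open>b\<close> in a positive set, and these choices form a 0-1 sequence of length \<open>\<xi>\<close>, the
  branch of \<open>b\<close>. The branch grows when \<open>b\<close> shrinks, and the two pieces of \<open>b\<close> have branches that
  disagree at \<open>\<xi>\<close>.

  Each member \<open>a\<close> is added together with a label \<open>\<sigma>\<close>, a 0-1 sequence of length less than \<open>\<kappa>\<close>,
  such that \<open>a\<close> is almost contained in the side of \<open>e \<zeta>\<close> named by \<open>\<sigma> \<zeta>\<close>, for all \<open>\<zeta>\<close> in the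
  domain of \<open>\<sigma>\<close>, and distinct members have distinct labels. Given a positive \<open>b\<close>, cut it
  repeatedly into two positive pieces. Decreasing sequences of positive sets have positive
  pseudointersections (\<open>id_plus_pseudointersection\<close>), so this produces continuum many positive
  subsets of \<open>b\<close> with pairwise incompatible branches (\<open>perfect_tree\<close>). As there are fewer
  earlier labels than that, some positive \<open>c \<subseteq> b\<close> has a branch \<open>\<tau>\<close> that no earlier label extends.
  Label the new member by \<open>\<tau>\<close>. Earlier members whose label is incompatible with \<open>\<tau>\<close> are then
  almost disjoint from it for free. The other labels are initial segments of \<open>\<tau>\<close>, so there are
  fewer than \<open>\<kappa>\<close> of them. Finally \<open>c\<close> respects the sides named by \<open>\<tau>\<close> only modulo the ideal, so
  the finitely many members covering each of the fewer than \<open>\<kappa>\<close> errors have to be avoided as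
  well. In total fewer than \<open>\<kappa>\<close> members remain, and \<open>a_star_extend\<close> applies
  (\<open>extension_step\<close>).
\<close>

section \<open>Positive sets of an almost disjoint family\<close>

lemma mem_id_of_iff: "X \<in> id_of A \<longleftrightarrow> (\<exists>F\<subseteq>A. finite F \<and> X \<subseteq>* \<Union>F)"
proof -
  let ?G = "{X. \<exists>F\<subseteq>A. finite F \<and> X \<subseteq>* \<Union>F}"
  have "set_ideal ?G"
    unfolding set_ideal_def
  proof (intro conjI ballI allI impI)
    show "{} \<in> ?G" by (auto simp: almost_subset_def)
  next
    fix X Y assume "X \<in> ?G" "Y \<subseteq> X"
    then show "Y \<in> ?G"
      by (auto simp: almost_subset_def intro: finite_subset[OF Diff_mono[OF _ subset_refl]])
  next
    fix X Y assume "X \<in> ?G" "Y \<in> ?G"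
    then obtain F H where "F \<subseteq> A" "finite F" "finite (X - \<Union>F)"
      and "H \<subseteq> A" "finite H" "finite (Y - \<Union>H)"
      by (auto simp: almost_subset_def)
    moreover have "X \<union> Y - \<Union>(F \<union> H) \<subseteq> (X - \<Union>F) \<union> (Y - \<Union>H)" by auto
    ultimately have "F \<union> H \<subseteq> A \<and> finite (F \<union> H) \<and> X \<union> Y \<subseteq>* \<Union>(F \<union> H)"
      unfolding almost_subset_def by (meson finite_UnI finite_subset Un_least)
    then show "X \<union> Y \<in> ?G" by blast
  qed
  moreover have "A \<union> {F. finite F} \<subseteq> ?G"
  proof
    fix X assume "X \<in> A \<union> {F. finite F}"
    then consider "X \<in> A" | "finite X" by auto
    then show "X \<in> ?G"
    proof cases
      case 1
      then show ?thesis
        by (intro CollectI exI[of _ "{X}"]) (auto simp: almost_subset_def)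
    next
      case 2
      then show ?thesis
        by (intro CollectI exI[of _ "{}"]) (auto simp: almost_subset_def)
    qed
  qed
  ultimately have "id_of A \<subseteq> ?G"
    unfolding id_of_def by (rule hull_minimal[rotated])
  moreover have "X \<in> id_of A" if F: "F \<subseteq> A" "finite F" "finite (X - \<Union>F)" for X F
    unfolding id_of_def hull_def
  proof (rule InterI, elim CollectE conjE)
    fix I assume I: "set_ideal I" "A \<union> {F. finite F} \<subseteq> I"
    have "\<Union>F \<in> I"
      using F(2,1) by induction (use I in \<open>auto simp: set_ideal_def\<close>)
    moreover have "X - \<Union>F \<in> I" using F(3) I(2) by auto
    ultimately have "\<Union>F \<union> (X - \<Union>F) \<in> I" using I(1) unfolding set_ideal_def by blast
    moreover have "X \<subseteq> \<Union>F \<union> (X - \<Union>F)" by auto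
    ultimately show "X \<in> I" using I(1) unfolding set_ideal_def by meson
  qed
  ultimately show ?thesis unfolding almost_subset_def by blast
qed

lemma id_plus_iff: "X \<in> id_plus A \<longleftrightarrow> (\<forall>F\<subseteq>A. finite F \<longrightarrow> infinite (X - \<Union>F))"
proof -
  have "infinite X" if "\<forall>F\<subseteq>A. finite F \<longrightarrow> infinite (X - \<Union>F)"
    using that[rule_format, of "{}"] by auto
  then show ?thesis
    unfolding id_plus_def ctbl_inf_subsets_def using mem_id_of_iff[of X A]
    by (auto simp: almost_subset_def)
qed

lemma id_plus_infinite: "X \<in> id_plus A \<Longrightarrow> infinite X"
  by (auto simp: id_plus_def ctbl_inf_subsets_def)

lemma id_plus_antimono: "A \<subseteq> B \<Longrightarrow> X \<in> id_plus B \<Longrightarrow> X \<in> id_plus A"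
  by (auto simp: id_plus_iff)

lemma id_plus_almost_mono:
  assumes "X \<in> id_plus A" "X \<subseteq>* Y"
  shows "Y \<in> id_plus A"
  unfolding id_plus_iff
proof (intro allI impI notI)
  fix F assume F: "F \<subseteq> A" "finite F" "finite (Y - \<Union>F)"
  have "X - \<Union>F \<subseteq> (X - Y) \<union> (Y - \<Union>F)" by auto
  then have "finite (X - \<Union>F)" using F(3) assms(2) unfolding almost_subset_def
    by (meson finite_UnI finite_subset)
  with assms(1) F show False by (auto simp: id_plus_iff)
qed

lemma id_plus_Diff: "X \<in> id_plus A \<Longrightarrow> F \<subseteq> A \<Longrightarrow> finite F \<Longrightarrow> X - \<Union>F \<in> id_plus A"
  unfolding id_plus_iff
proof (intro allI impI)
  fix H assume "\<forall>F\<subseteq>A. finite F \<longrightarrow> infinite (X - \<Union>F)" "F \<subseteq> A" "finite F" "H \<subseteq> A" "finite H"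
  then have "infinite (X - \<Union>(F \<union> H))" by (meson Un_least finite_UnI)
  moreover have "X - \<Union>(F \<union> H) = X - \<Union>F - \<Union>H" by auto
  ultimately show "infinite (X - \<Union>F - \<Union>H)" by simp
qed

lemma id_plus_half:
  assumes "X \<in> id_plus A"
  shows "X \<inter> E \<in> id_plus A \<or> X - E \<in> id_plus A"
proof (rule ccontr)
  assume "\<not> ?thesis"
  then obtain F H where "F \<subseteq> A" "finite F" "finite (X \<inter> E - \<Union>F)"
    "H \<subseteq> A" "finite H" "finite (X - E - \<Union>H)"
    by (auto simp: id_plus_iff)
  moreover have "X - \<Union>(F \<union> H) \<subseteq> (X \<inter> E - \<Union>F) \<union> (X - E - \<Union>H)" by auto
  ultimately show False using assms unfolding id_plus_iff
    by (metis Un_subset_iff finite_UnI finite_subset)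
qed

lemma id_plus_if_disjoint:
  assumes "Y \<subseteq> X" "infinite Y" "\<And>x. x \<in> A \<Longrightarrow> almost_disjoint Y x"
  shows "X \<in> id_plus A"
  unfolding id_plus_iff
proof (intro allI impI notI)
  fix F assume F: "F \<subseteq> A" "finite F" "finite (X - \<Union>F)"
  have "Y \<subseteq> (X - \<Union>F) \<union> (\<Union>x\<in>F. Y \<inter> x)" using assms(1) by auto
  moreover have "finite (\<Union>x\<in>F. Y \<inter> x)" using assms(3) F
    by (intro finite_UN_I) (auto simp: almost_disjoint_def simp del: Int_UN_distrib)
  ultimately show False using assms(2) F(3) by (meson finite_UnI finite_subset)
qed

text \<open>
  Finitely many members of an almost disjoint family cannot almost cover \<open>X\<close> here, since each of
  the infinitely many other members \<open>x\<close> with \<open>X \<inter> x\<close> infinite is almost disjoint from them.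
\<close>

lemma id_plus_if_infinite_meets:
  assumes AD: "pairwise almost_disjoint A" and inf: "infinite {x\<in>A. infinite (X \<inter> x)}"
  shows "X \<in> id_plus A"
  unfolding id_plus_iff
proof (intro allI impI notI)
  fix F assume F: "F \<subseteq> A" "finite F" "finite (X - \<Union>F)"
  obtain x where x: "x \<in> A" "infinite (X \<inter> x)" "x \<notin> F"
    using inf F(2) by (metis (mono_tags, lifting) finite_subset mem_Collect_eq subsetI)
  have "finite (x \<inter> y)" if "y \<in> F" for y
    using AD x(1,3) that F(1) unfolding pairwise_def almost_disjoint_def by (metis subsetD)
  moreover have "X \<inter> x \<subseteq> (X - \<Union>F) \<union> (\<Union>y\<in>F. x \<inter> y)" by auto
  ultimately show False using x(2) F by (meson finite_UN finite_UnI finite_subset)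
qed

text \<open>
  Together with \<open>id_plus_if_disjoint\<close> and \<open>id_plus_if_infinite_meets\<close> this characterizes the
  positive sets of an almost disjoint family: if only finitely many members meet \<open>X\<close> in an
  infinite set, then removing them from \<open>X\<close> leaves the set \<open>Y\<close>. All combinatorial
  constructions of positive sets below go through these two cases.
\<close>

lemma id_plus_cases:
  assumes "X \<in> id_plus A"
  obtains (meets) "infinite {x\<in>A. infinite (X \<inter> x)}"
  | (disjoint) Y where "Y \<subseteq> X" "infinite Y" "\<And>x. x \<in> A \<Longrightarrow> almost_disjoint Y x"
proof (cases "finite {x\<in>A. infinite (X \<inter> x)}")
  case True
  let ?Y = "X - \<Union>{x\<in>A. infinite (X \<inter> x)}"
  have "infinite ?Y" using assms True by (auto simp: id_plus_iff)
  moreover have "almost_disjoint ?Y x" if "x \<in> A" for x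
  proof (cases "finite (X \<inter> x)")
    case True
    then show ?thesis unfolding almost_disjoint_def by (rule rev_finite_subset) auto
  next
    case False
    then have "?Y \<inter> x = {}" using that by auto
    then show ?thesis by (simp add: almost_disjoint_def)
  qed
  ultimately show ?thesis using disjoint[of ?Y] by blast
qed (rule meets)

lemma decseq_pseudointersection:
  fixes b :: "nat \<Rightarrow> nat set"
  assumes dec: "\<And>n. b (Suc n) \<subseteq> b n" and inf: "\<And>n. infinite (b n)"
  obtains p where "infinite p" "p \<subseteq> b 0" "\<And>n. p \<subseteq>* b n"
proof -
  have "\<forall>n m. \<exists>k>m. k \<in> b n" using inf by (meson infinite_nat_iff_unbounded)
  then obtain h where h: "\<And>n m. h n m > m" "\<And>n m. h n m \<in> b n" by metis
  define q where "q = rec_nat (h 0 0) (\<lambda>n m. h (Suc n) m)"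
  have q: "q n \<in> b n" for n by (cases n) (simp_all add: q_def h)
  have "strict_mono q" by (rule strict_mono_Suc_iff[THEN iffD2]) (simp add: q_def h)
  then have "infinite (range q)" by (simp add: finite_image_iff strict_mono_imp_inj_on)
  moreover have mono: "b m \<subseteq> b n" if "n \<le> m" for n m
    using lift_Suc_antimono_le[of b] dec that by blast
  moreover have "range q \<subseteq>* b n" for n
  proof -
    have "range q - b n \<subseteq> q ` {..<n}"
    proof
      fix m assume "m \<in> range q - b n"
      then obtain k where "m = q k" "q k \<notin> b n" by blast
      moreover from this have "k < n" using mono[of n k] q[of k] by (meson not_less subsetD)
      ultimately show "m \<in> q ` {..<n}" by blast
    qed
    then show ?thesis unfolding almost_subset_def by (meson finite_imageI finite_lessThan finite_subset)
  qed
  ultimately show ?thesis using that[of "range q"] q mono[of 0] by blast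
qed

text \<open>
  If no pseudointersection of the sequence is almost disjoint from the whole family, then any
  pseudointersection has an infinite piece inside some member. Removing from all \<open>b n\<close> the
  members found so far keeps them positive, so infinitely many members contain infinite
  pseudointersections. A diagonal union of these pieces meets infinitely many members in an
  infinite set, hence is positive.
\<close>

lemma id_plus_pseudointersection:
  fixes b :: "nat \<Rightarrow> nat set"
  assumes AD: "pairwise almost_disjoint A"
    and dec: "\<And>n. b (Suc n) \<subseteq> b n" and pos: "\<And>n. b n \<in> id_plus A"
  obtains p where "p \<in> id_plus A" "p \<subseteq> b 0" "\<And>n. p \<subseteq>* b n"
proof (cases "\<exists>p. infinite p \<and> p \<subseteq> b 0 \<and> (\<forall>n. p \<subseteq>* b n) \<and> (\<forall>x\<in>A. almost_disjoint p x)")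
  case True
  then obtain p where "infinite p" "p \<subseteq> b 0" "\<forall>n. p \<subseteq>* b n" "\<forall>x\<in>A. almost_disjoint p x"
    by blast
  then show ?thesis using that[of p] id_plus_if_disjoint[of p p A] by blast
next
  case False
  define R where "R q x \<longleftrightarrow> infinite q \<and> q \<subseteq> x \<and> q \<subseteq> b 0 \<and> (\<forall>n. q \<subseteq>* b n)" for q x
  let ?M = "{x\<in>A. \<exists>q. R q x}"
  have infM: "infinite ?M"
  proof
    assume fin: "finite ?M"
    have "infinite (b n - \<Union>?M)" for n
      using id_plus_Diff[OF pos _ fin] id_plus_infinite by blast
    then obtain p where p: "infinite p" "p \<subseteq> b 0 - \<Union>?M" "\<And>n. p \<subseteq>* b n - \<Union>?M"
      using decseq_pseudointersection[of "\<lambda>n. b n - \<Union>?M"] dec by (metis (no_types, lifting) Diff_mono subset_refl)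
    have pb: "p \<subseteq>* b n" for n
      using p(3)[of n] unfolding almost_subset_def by (rule rev_finite_subset) auto
    then obtain x where x: "x \<in> A" "infinite (p \<inter> x)"
      using False p(1,2) unfolding almost_disjoint_def by blast
    have "p \<inter> x \<subseteq>* b n" for n
      using pb[of n] unfolding almost_subset_def by (rule rev_finite_subset) auto
    then have "R (p \<inter> x) x" using x p(2) unfolding R_def by blast
    then have "p \<inter> x = {}" using x p(2) by blast
    then show False using x(2) by simp
  qed
  obtain f :: "nat \<Rightarrow> nat set" where f: "inj f" "range f \<subseteq> ?M"
    using infinite_countable_subset[OF infM] by blast
  then have "\<forall>k. \<exists>q. R q (f k)" by blast
  then obtain q where q: "\<And>k. R (q k) (f k)" by metis
  have mono: "b m \<subseteq> b n" if "n \<le> m" for n m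
    using lift_Suc_antimono_le[of b] dec that by blast
  \<comment> \<open>Only the pieces with index below \<open>n\<close> contribute points outside \<open>b n\<close>, each only
     finitely many.\<close>
  define p where "p = (\<Union>k. q k \<inter> b k)"
  have pb: "p \<subseteq>* b n" for n
  proof -
    have "p - b n \<subseteq> (\<Union>k<n. q k - b n)"
    proof
      fix m assume "m \<in> p - b n"
      then obtain k where "m \<in> q k" "m \<in> b k" "m \<notin> b n" unfolding p_def by blast
      moreover from this have "k < n" using mono[of n k] by (meson not_less subsetD)
      ultimately show "m \<in> (\<Union>k<n. q k - b n)" by blast
    qed
    moreover have "finite (\<Union>k<n. q k - b n)"
      using q by (intro finite_UN_I) (simp_all add: R_def almost_subset_def)
    ultimately show ?thesis unfolding almost_subset_def by (rule finite_subset)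
  qed
  have "infinite (p \<inter> f k)" for k
  proof
    assume "finite (p \<inter> f k)"
    moreover have qk: "infinite (q k)" "q k \<subseteq> f k" "finite (q k - b k)"
      using q[of k] by (auto simp: R_def almost_subset_def)
    moreover have "q k \<subseteq> (q k - b k) \<union> (p \<inter> f k)" using qk(2) unfolding p_def by blast
    ultimately show False by (meson finite_UnI finite_subset)
  qed
  then have "range f \<subseteq> {x\<in>A. infinite (p \<inter> x)}" using f(2) by blast
  then have "p \<in> id_plus A"
    using id_plus_if_infinite_meets[OF AD] f(1) by (meson finite_subset range_inj_infinite)
  moreover have "p \<subseteq> b 0" using q unfolding p_def R_def by auto
  ultimately show ?thesis using pb that[of p] by blast
qed

section \<open>Consequences of the value of the cardinal a-star\<close>

text \<open>
  The positive set \<open>c\<close> may be assumed to meet infinitely many members. The traces on \<open>c\<close> of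
  countably many of them serve as the last \<open>\<omega>\<close> entries of a sequence, the traces of the others
  as the first fewer than \<open>\<kappa>\<close> entries. By the minimality of \<open>\<kappa>\<close> some \<open>B\<close> is almost disjoint
  from the latter and meets infinitely many of the former in an infinite set. Picking one point of
  \<open>B\<close> from each of these makes the resulting set almost disjoint from the former as well.
\<close>

lemma a_star_extend:
  fixes \<kappa> :: "'k rel"
  assumes star: "is_a_star \<kappa>" and AD: "pairwise almost_disjoint F"
    and small: "|F| <o \<kappa>" and c: "c \<in> id_plus F"
  obtains d where "d \<subseteq> c" "infinite d" "\<And>x. x \<in> F \<Longrightarrow> almost_disjoint d x"
  using c
proof (cases rule: id_plus_cases)
  case meets
  let ?M = "{x\<in>F. infinite (c \<inter> x)}"
  obtain f :: "nat \<Rightarrow> nat set" where f: "inj f" "range f \<subseteq> ?M"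
    using infinite_countable_subset[OF meets] by blast
  define D where "D = ?M - range f"
  have D_small: "|D| <o \<kappa>"
  proof -
    have "D \<subseteq> F" unfolding D_def by blast
    then show ?thesis using card_of_mono1 small ordLeq_ordLess_trans by blast
  qed
  have ADi: "finite (x \<inter> y)" if "x \<in> ?M" "y \<in> ?M" "x \<noteq> y" for x y
    using AD that by (auto simp: pairwise_def almost_disjoint_def)
  have "Card_order \<kappa>" using star by (simp add: is_a_star_def)
  from ordLeq_ordIso_trans[OF ordLess_imp_ordLeq[OF D_small] ordIso_symmetric[OF card_of_Field_ordIso[OF this]]]
  have "\<exists>h. inj_on h D \<and> h ` D \<subseteq> Field \<kappa>" by (rule card_of_ordLeq[THEN iffD2])
  then obtain h where h: "inj_on h D" "h ` D \<subseteq> Field \<kappa>" by blast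
  \<comment> \<open>The index cardinal has to live on the type of \<open>\<kappa>\<close>, so the remaining members are
     indexed by their images in the field of \<open>\<kappa>\<close>.\<close>
  define \<mu> where "\<mu> = |h ` D|"
  define A where "A = case_sum (\<lambda>\<alpha>. c \<inter> the_inv_into D h \<alpha>) (\<lambda>n::nat. c \<inter> f n)"
  define X where "X = case_sum (the_inv_into D h) f"
  have FM: "Field \<mu> = h ` D" by (simp add: \<mu>_def Field_card_of)
  have A_X: "A i = c \<inter> X i" for i by (cases i) (simp_all add: A_def X_def)
  have inv: "the_inv_into D h \<alpha> \<in> D" if "\<alpha> \<in> h ` D" for \<alpha>
    using the_inv_into_into[OF h(1) that] by blast
  have XM: "X i \<in> ?M" if "i \<in> Field \<mu> <+> UNIV" for i
    using that inv f(2) unfolding FM X_def D_def by (cases i) auto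
  have X_inj: "X i \<noteq> X j" if "i \<in> Field \<mu> <+> UNIV" "j \<in> Field \<mu> <+> UNIV" "i \<noteq> j" for i j
  proof (cases i; cases j)
    fix \<alpha> \<beta> assume "i = Inl \<alpha>" "j = Inl \<beta>"
    then show ?thesis using that h(1) unfolding FM X_def
      by (auto simp: the_inv_into_f_f)
  next
    fix \<alpha> n assume "i = Inl \<alpha>" "j = Inr n"
    then show ?thesis using that inv[of \<alpha>] unfolding FM X_def D_def by auto
  next
    fix \<alpha> n assume "i = Inr n" "j = Inl \<alpha>"
    then show ?thesis using that inv[of \<alpha>] unfolding FM X_def D_def by fastforce
  next
    fix n m assume "i = Inr n" "j = Inr m"
    then show ?thesis using that f(1) unfolding X_def by (auto simp: inj_eq)
  qed
  have "\<not> a_star_sequence \<mu> A"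
  proof
    assume "a_star_sequence \<mu> A"
    moreover have "Card_order \<mu>" by (simp add: \<mu>_def card_of_Card_order)
    ultimately have "\<kappa> \<le>o \<mu>" using star unfolding is_a_star_def by blast
    moreover have "\<mu> \<le>o |D|" unfolding \<mu>_def by (rule card_of_image)
    ultimately show False using D_small
      by (meson not_ordLess_ordLeq ordLeq_transitive)
  qed
  moreover have "infinite (A i)" if "i \<in> Field \<mu> <+> UNIV" for i
    using XM[OF that] unfolding A_X by blast
  moreover have "almost_disjoint (A i) (A j)"
    if "i \<in> Field \<mu> <+> UNIV" "j \<in> Field \<mu> <+> UNIV" "i \<noteq> j" for i j
    using ADi[OF XM XM X_inj, OF that(1,2) that] unfolding A_X almost_disjoint_def
    by (rule rev_finite_subset) auto
  ultimately obtain B where B: "\<And>\<alpha>. \<alpha> \<in> Field \<mu> \<Longrightarrow> almost_disjoint B (A (Inl \<alpha>))"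
    and N: "infinite {n. infinite (B \<inter> A (Inr n))}"
    unfolding a_star_sequence_def by blast
  define N' where "N' = {n. infinite (B \<inter> (c \<inter> f n))}"
  have infN': "infinite N'" using N unfolding A_def N'_def by simp
  define s where "s = enumerate N'"
  have s_in: "s k \<in> N'" for k using enumerate_in_set[OF infN'] s_def by simp
  have s_inj: "inj s" using strict_mono_imp_inj_on[OF strict_mono_enumerate[OF infN']] s_def by simp
  \<comment> \<open>Avoiding the earlier \<open>f (s j)\<close> makes the points distinct and lets each \<open>f (s k)\<close> contain
     only finitely many of them.\<close>
  have "\<exists>y. y \<in> B \<inter> c \<inter> f (s k) - (\<Union>j<k. f (s j))" for k
  proof (rule ccontr)
    assume "\<nexists>y. y \<in> B \<inter> c \<inter> f (s k) - (\<Union>j<k. f (s j))"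
    then have "B \<inter> (c \<inter> f (s k)) \<subseteq> (\<Union>j<k. f (s k) \<inter> f (s j))" by blast
    moreover have "finite (f (s k) \<inter> f (s j))" if "j < k" for j
      using ADi[of "f (s k)" "f (s j)"] f s_inj that by (auto simp: inj_eq)
    then have "finite (\<Union>j<k. f (s k) \<inter> f (s j))" by (intro finite_UN_I) auto
    ultimately have "finite (B \<inter> (c \<inter> f (s k)))" by (rule finite_subset)
    then show False using s_in[of k] unfolding N'_def by blast
  qed
  then obtain y where y: "\<And>k. y k \<in> B \<inter> c \<inter> f (s k) - (\<Union>j<k. f (s j))" by metis
  have y_inj: "inj y"
  proof (rule injI)
    fix i j assume "y i = y j"
    then show "i = j" using y[of i] y[of j] by (cases i j rule: linorder_cases) auto
  qed
  have "almost_disjoint (range y) x" if x: "x \<in> F" for x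
  proof -
    consider "x \<notin> ?M" | n where "x = f n" "n \<notin> N'" | k where "x = f (s k)" | "x \<in> D"
      using x unfolding D_def s_def using enumerate_Ex[OF infN'] by blast
    then show ?thesis
    proof cases
      case 1
      then have "finite (c \<inter> x)" using x by blast
      moreover have "range y \<inter> x \<subseteq> c \<inter> x" using y by blast
      ultimately show ?thesis unfolding almost_disjoint_def by (rule rev_finite_subset)
    next
      case 2
      then have "finite (B \<inter> (c \<inter> x))" unfolding N'_def by blast
      moreover have "range y \<inter> x \<subseteq> B \<inter> (c \<inter> x)" using y by blast
      ultimately show ?thesis unfolding almost_disjoint_def by (rule rev_finite_subset)
    next
      case 3
      have "range y \<inter> x \<subseteq> y ` {..k}" unfolding 3 using y by (force simp: not_le)
      then show ?thesis unfolding almost_disjoint_def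
        by (meson finite_atMost finite_imageI finite_subset)
    next
      case 4
      then have "finite (B \<inter> (c \<inter> x))"
        using B[of "h x"] h(1) unfolding FM A_def almost_disjoint_def
        by (simp add: the_inv_into_f_f)
      moreover have "range y \<inter> x \<subseteq> B \<inter> (c \<inter> x)" using y by blast
      ultimately show ?thesis unfolding almost_disjoint_def by (rule rev_finite_subset)
    qed
  qed
  then show ?thesis using that[of "range y"] y y_inj range_inj_infinite by blast
next
  case (disjoint Y)
  then show ?thesis using that by blast
qed

text \<open>
  Let \<open>f \<alpha> n\<close> bound the intersection of the \<open>\<alpha>\<close>-th set with the \<open>n\<close>-th of the last \<open>\<omega>\<close> sets.
  If some \<open>g\<close> dominated all \<open>f \<alpha>\<close>, removing the points below \<open>g n\<close> from the \<open>n\<close>-th of the last sets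
  and taking the union would give a set of the kind whose absence defines an \<open>\<aa>\<^sub>*\<close>-sequence.
\<close>

lemma a_star_unbounded_family:
  fixes \<kappa> :: "'k rel"
  assumes "is_a_star \<kappa>"
  obtains f :: "'k \<Rightarrow> nat \<Rightarrow> nat"
  where "\<And>g. \<exists>\<alpha>\<in>Field \<kappa>. infinite {n. g n < f \<alpha> n}"
proof -
  obtain A where A: "a_star_sequence \<kappa> A" using assms unfolding is_a_star_def by blast
  have fin: "finite (A (Inl \<alpha>) \<inter> A (Inr n))" if "\<alpha> \<in> Field \<kappa>" for \<alpha> n
    using A that unfolding a_star_sequence_def almost_disjoint_def by blast
  have "\<exists>k. \<alpha> \<in> Field \<kappa> \<longrightarrow> A (Inl \<alpha>) \<inter> A (Inr n) \<subseteq> {..<k}" for \<alpha> n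
    using fin[of \<alpha> n] finite_nat_iff_bounded by blast
  then obtain f where f: "\<And>\<alpha> n. \<alpha> \<in> Field \<kappa> \<Longrightarrow> A (Inl \<alpha>) \<inter> A (Inr n) \<subseteq> {..<f \<alpha> n}" by metis
  have "\<exists>\<alpha>\<in>Field \<kappa>. infinite {n. g n < f \<alpha> n}" for g
  proof (rule ccontr)
    assume "\<not> ?thesis"
    then have g: "finite {n. g n < f \<alpha> n}" if "\<alpha> \<in> Field \<kappa>" for \<alpha> using that by blast
    define B where "B = (\<Union>n. A (Inr n) - {..<g n})"
    have inf: "infinite (B \<inter> A (Inr n))" for n
    proof
      assume "finite (B \<inter> A (Inr n))"
      moreover have "A (Inr n) \<subseteq> B \<inter> A (Inr n) \<union> {..<g n}" unfolding B_def by blast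
      ultimately have "finite (A (Inr n))" by (meson finite_UnI finite_lessThan finite_subset)
      then show False using A unfolding a_star_sequence_def by blast
    qed
    have "almost_disjoint B (A (Inl \<alpha>))" if \<alpha>: "\<alpha> \<in> Field \<kappa>" for \<alpha>
    proof -
      have "B \<inter> A (Inl \<alpha>) \<subseteq> (\<Union>n\<in>{n. g n < f \<alpha> n}. A (Inl \<alpha>) \<inter> A (Inr n))"
      proof
        fix m assume "m \<in> B \<inter> A (Inl \<alpha>)"
        then obtain n where "m \<in> A (Inl \<alpha>) \<inter> A (Inr n)" "\<not> m < g n" unfolding B_def by blast
        moreover from this have "m < f \<alpha> n" using f[OF \<alpha>, of n] by blast
        ultimately show "m \<in> (\<Union>n\<in>{n. g n < f \<alpha> n}. A (Inl \<alpha>) \<inter> A (Inr n))" by force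
      qed
      moreover have "finite (\<Union>n\<in>{n. g n < f \<alpha> n}. A (Inl \<alpha>) \<inter> A (Inr n))"
        using g[OF \<alpha>] fin[OF \<alpha>] by (intro finite_UN_I)
      ultimately show ?thesis unfolding almost_disjoint_def by (rule finite_subset)
    qed
    moreover have "infinite B" using inf[of 0] by (meson finite_Int)
    moreover have "infinite {n. infinite (B \<inter> A (Inr n))}" using inf by simp
    ultimately show False using A unfolding a_star_sequence_def by blast
  qed
  then show ?thesis using that by blast
qed

text \<open>
  A finite family of functions is dominated by its sum.
\<close>

lemma a_star_infinite:
  assumes "is_a_star \<kappa>"
  shows "infinite (Field \<kappa>)"
proof
  assume fin: "finite (Field \<kappa>)"
  obtain f where f: "\<exists>\<alpha>\<in>Field \<kappa>. infinite {n. g n < f \<alpha> n}" for g :: "nat \<Rightarrow> nat"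
    using a_star_unbounded_family[OF assms] by blast
  obtain \<alpha> where \<alpha>: "\<alpha> \<in> Field \<kappa>" "infinite {n. (\<Sum>\<beta>\<in>Field \<kappa>. f \<beta> n) < f \<alpha> n}"
    using f[of "\<lambda>n. \<Sum>\<beta>\<in>Field \<kappa>. f \<beta> n"] by blast
  have "f \<alpha> n \<le> (\<Sum>\<beta>\<in>Field \<kappa>. f \<beta> n)" for n
    using member_le_sum[of \<alpha> "Field \<kappa>" "\<lambda>\<beta>. f \<beta> n"] \<alpha>(1) fin by simp
  then have "{n. (\<Sum>\<beta>\<in>Field \<kappa>. f \<beta> n) < f \<alpha> n} = {}" by (simp add: not_less)
  then show False using \<alpha>(2) by simp
qed

section \<open>Splitting countably many sets at once\<close>

text \<open>
  The function \<open>f\<close> induces a partition of the natural numbers into finite intervals. The sum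
  makes each block longer than every value of \<open>f\<close> at a point up to its left end.
\<close>

primrec block_start :: "(nat \<Rightarrow> nat) \<Rightarrow> nat \<Rightarrow> nat" where
  "block_start f 0 = 0"
| "block_start f (Suc k) = Suc (block_start f k + (\<Sum>j\<le>block_start f k. f j))"

definition block :: "(nat \<Rightarrow> nat) \<Rightarrow> nat \<Rightarrow> nat set" where
  "block f k = {block_start f k..<block_start f (Suc k)}"

lemma strict_mono_block_start: "strict_mono (block_start f)"
  by (rule strict_mono_Suc_iff[THEN iffD2]) simp

lemma block_start_ge: "k \<le> block_start f k"
  by (rule strict_mono_imp_increasing[OF strict_mono_block_start])

lemma block_unique: "y \<in> block f i \<Longrightarrow> y \<in> block f j \<Longrightarrow> i = j"
  unfolding block_def using strict_mono_less[OF strict_mono_block_start, of f]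
  by (metis atLeastLessThan_iff le_less_trans less_Suc_eq_le order_antisym)

lemma block_exists: "\<exists>k. m \<in> block f k"
proof -
  let ?j = "LEAST j. m < block_start f j"
  have "m < block_start f (Suc m)" using block_start_ge[of "Suc m" f] by simp
  then have j: "m < block_start f ?j" by (rule LeastI)
  then obtain k where k: "?j = Suc k" by (cases ?j) auto
  then have "\<not> m < block_start f k" using not_less_Least[of k "\<lambda>j. m < block_start f j"] by simp
  then have "m \<in> block f k" using j unfolding k block_def by simp
  then show ?thesis ..
qed

lemma block_gap:
  assumes "m < block_start f (Suc k)"
  shows "f m < block_start f (Suc (Suc k))"
proof -
  have "f m \<le> (\<Sum>j\<le>block_start f (Suc k). f j)"
    using assms by (intro member_le_sum) auto
  then show ?thesis unfolding block_start.simps(2)[of f "Suc k"] by linarith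
qed

text \<open>
  Choose \<open>h\<close> such that the interval from \<open>m\<close> to \<open>h m\<close> meets \<open>a n\<close> for all \<open>n \<le> m\<close>, and let
  \<open>g = h \<circ> h\<close>. If \<open>h (h m) < f m\<close> and \<open>m\<close> lies in block \<open>k\<close>, then \<open>h (h m)\<close> comes before the end of
  block \<open>k + 1\<close>. The single boundary between these two blocks cuts at most one of the
  consecutive intervals from \<open>m\<close> to \<open>h m\<close> and from \<open>h m\<close> to \<open>h (h m)\<close>, so the other one lies
  inside block \<open>k\<close> or block \<open>k + 1\<close>.
\<close>

lemma infinitely_many_blocks_meet:
  fixes a :: "nat \<Rightarrow> nat set"
  assumes inf: "\<And>n. infinite (a n)"
  shows "\<exists>g. \<forall>f. infinite {n. g n < f n} \<longrightarrow> infinite {k. \<forall>n<k. a n \<inter> block f k \<noteq> {}}"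
proof -
  have "\<forall>n m. \<exists>y\<ge>m. y \<in> a n" using inf by (meson infinite_nat_iff_unbounded_le)
  then obtain t where t: "\<And>n m. m \<le> t n m" "\<And>n m. t n m \<in> a n" by metis
  define h where "h m = Suc (\<Sum>n\<le>m. t n m)" for m
  have t_h: "t n m < h m" if "n \<le> m" for n m
    using member_le_sum[of n "{..m}" "\<lambda>n. t n m"] that by (simp add: h_def less_Suc_eq_le)
  have h_gt: "m < h m" for m using t_h[of 0 m] t(1)[of m 0] by simp
  have "infinite {k. \<forall>n<k. a n \<inter> block f k \<noteq> {}}" if f: "infinite {n. h (h n) < f n}" for f
    unfolding infinite_nat_iff_unbounded_le
  proof
    fix K
    obtain m where m: "block_start f K \<le> m" "h (h m) < f m"
      using f unfolding infinite_nat_iff_unbounded_le by blast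
    obtain k where k: "m \<in> block f k" using block_exists by blast
    then have k': "block_start f k \<le> m" "m < block_start f (Suc k)" by (auto simp: block_def)
    have "block_start f K < block_start f (Suc k)" using m(1) k'(2) by simp
    then have Kk: "K \<le> k"
      unfolding strict_mono_less[OF strict_mono_block_start] by (rule less_Suc_eq_le[THEN iffD1])
    have km: "k \<le> m" using block_start_ge[of k f] k'(1) by simp
    have end2: "h (h m) < block_start f (Suc (Suc k))" using m(2) block_gap[OF k'(2)] by simp
    show "\<exists>k\<ge>K. k \<in> {k. \<forall>n<k. a n \<inter> block f k \<noteq> {}}"
    proof (cases "h m \<le> block_start f (Suc k)")
      case True
      have "t n m \<in> a n \<inter> block f k" if "n < k" for n
        using t(1)[of m n] t(2)[of n m] t_h[of n m] that km k' True by (auto simp: block_def)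
      then show ?thesis using Kk by blast
    next
      case False
      have "t n (h m) \<in> a n \<inter> block f (Suc k)" if "n < Suc k" for n
        using t(1)[of "h m" n] t(2)[of n "h m"] t_h[of n "h m"] that km h_gt[of m] end2 False
        unfolding block_def by (auto simp del: block_start.simps)
      then have "Suc k \<in> {k. \<forall>n<k. a n \<inter> block f k \<noteq> {}}" by fast
      then show ?thesis using le_SucI[OF Kk] by blast
    qed
  qed
  then show ?thesis by (intro exI[of _ "\<lambda>n. h (h n)"] allI impI)
qed

lemma block_union_splits:
  assumes K: "infinite (C \<inter> {k. \<forall>n<k. a n \<inter> block f k \<noteq> {}})"
  shows "infinite (a n \<inter> (\<Union>k\<in>C. block f k))"
  unfolding infinite_nat_iff_unbounded_le
proof
  fix N
  obtain k where k: "max N (Suc n) \<le> k" "k \<in> C" "\<forall>n<k. a n \<inter> block f k \<noteq> {}"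
    using K unfolding infinite_nat_iff_unbounded_le by blast
  then obtain y where y: "y \<in> a n" "y \<in> block f k" by (metis IntE Suc_le_lessD ex_in_conv max.boundedE)
  then have "N \<le> y" using k(1) block_start_ge[of k f] by (auto simp: block_def)
  then show "\<exists>y\<ge>N. y \<in> a n \<inter> (\<Union>k\<in>C. block f k)" using y k(2) by blast
qed

text \<open>
  Given the sets \<open>a n\<close>, unboundedness provides a partition into blocks such that infinitely many
  blocks meet more and more of the \<open>a n\<close>. A set \<open>C\<close> that splits the set of indices of these blocks
  turns into the union of the blocks with index in \<open>C\<close>, which splits every \<open>a n\<close>. There are only
  \<open>\<kappa> \<cdot> \<kappa> = \<kappa>\<close> pairs of a splitting set and a partition.
\<close>

lemma omega_splitting_sequence:
  fixes \<kappa> :: "'k rel"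
  assumes s: "is_splitting_number \<kappa>" and star: "is_a_star \<kappa>"
  obtains e :: "'k \<Rightarrow> nat set" where
    "\<And>a. (\<And>n::nat. infinite (a n)) \<Longrightarrow>
       \<exists>\<xi>\<in>Field \<kappa>. \<forall>n. infinite (a n \<inter> e \<xi>) \<and> infinite (a n - e \<xi>)"
proof -
  obtain f :: "'k \<Rightarrow> nat \<Rightarrow> nat" where f: "\<And>g. \<exists>\<alpha>\<in>Field \<kappa>. infinite {n. g n < f \<alpha> n}"
    using a_star_unbounded_family[OF star] by blast
  obtain S where S: "splitting_family S" "|S| =o \<kappa>" and co: "Card_order \<kappa>"
    using s unfolding is_splitting_number_def is_min_card_def by blast
  have inf: "infinite (Field \<kappa>)" by (rule a_star_infinite[OF star])
  define E where "E = (\<lambda>(C, \<alpha>). \<Union>k\<in>C. block (f \<alpha>) k)"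
  have "|E ` (S \<times> Field \<kappa>)| \<le>o |S \<times> Field \<kappa>|" by (rule card_of_image)
  also have "|S \<times> Field \<kappa>| \<le>o \<kappa>"
    by (rule card_of_Times_ordLeq_infinite_Field[OF inf ordIso_imp_ordLeq[OF S(2)]
          ordIso_imp_ordLeq[OF card_of_Field_ordIso[OF co]] co])
  also have "\<kappa> \<le>o |Field \<kappa>|"
    by (rule ordIso_imp_ordLeq[OF ordIso_symmetric[OF card_of_Field_ordIso[OF co]]])
  finally have le: "|E ` (S \<times> Field \<kappa>)| \<le>o |Field \<kappa>|" .
  have splits: "\<exists>x\<in>E ` (S \<times> Field \<kappa>). \<forall>n. infinite (a n \<inter> x) \<and> infinite (a n - x)"
    if a: "\<And>n. infinite (a n)" for a :: "nat \<Rightarrow> nat set"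
  proof -
    obtain g where g: "\<forall>f. infinite {n. g n < f n} \<longrightarrow> infinite {k. \<forall>n<k. a n \<inter> block f k \<noteq> {}}"
      using infinitely_many_blocks_meet[OF a] ..
    obtain \<alpha> where \<alpha>: "\<alpha> \<in> Field \<kappa>" "infinite {n. g n < f \<alpha> n}" using f[of g] by blast
    let ?K = "{k. \<forall>n<k. a n \<inter> block (f \<alpha>) k \<noteq> {}}"
    have "?K \<in> [UNIV]\<^sup>\<omega>" using g \<alpha>(2) by (auto simp: ctbl_inf_subsets_def)
    then obtain C where C: "C \<in> S" "\<not> ?K \<subseteq>* C" "\<not> ?K \<subseteq>* - C"
      using S(1) unfolding splitting_family_def by blast
    have "infinite (C \<inter> ?K)" "infinite (- C \<inter> ?K)"
      using C(2,3) unfolding almost_subset_def by (simp_all add: Diff_eq Int_commute)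
    from this[THEN block_union_splits] have "infinite (a n \<inter> (\<Union>k\<in>C. block (f \<alpha>) k))"
      "infinite (a n \<inter> (\<Union>k\<in>- C. block (f \<alpha>) k))" for n by auto
    moreover have "a n \<inter> (\<Union>k\<in>- C. block (f \<alpha>) k) \<subseteq> a n - (\<Union>k\<in>C. block (f \<alpha>) k)" for n
      using block_unique by blast
    ultimately have "\<forall>n. infinite (a n \<inter> E (C, \<alpha>)) \<and> infinite (a n - E (C, \<alpha>))"
      unfolding E_def prod.case by (meson finite_subset)
    then show ?thesis using C(1) \<alpha>(1) by blast
  qed
  then have "E ` (S \<times> Field \<kappa>) \<noteq> {}" by (metis empty_iff infinite_UNIV_nat)
  then obtain e where e: "e ` Field \<kappa> = E ` (S \<times> Field \<kappa>)"
    using le card_of_ordLeq2[of "E ` (S \<times> Field \<kappa>)" "Field \<kappa>"] by auto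
  show ?thesis
  proof (rule that)
    fix a :: "nat \<Rightarrow> nat set" assume "\<And>n. infinite (a n)"
    from splits[of a, OF this] show "\<exists>\<xi>\<in>Field \<kappa>. \<forall>n. infinite (a n \<inter> e \<xi>) \<and> infinite (a n - e \<xi>)"
      unfolding e[symmetric] by blast
  qed
qed

section \<open>Small unions and transfinite recursion\<close>

lemma card_of_UN_finite_ordLess:
  fixes \<kappa> :: "'k rel"
  assumes co: "Card_order \<kappa>" and inf: "infinite (Field \<kappa>)"
    and I: "|I| <o \<kappa>" and fin: "\<And>i. i \<in> I \<Longrightarrow> finite (A i)"
  shows "|\<Union>i\<in>I. A i| <o \<kappa>"
proof (cases "finite I")
  case True
  then have "finite (\<Union>i\<in>I. A i)" using fin by blast
  then show ?thesis
    using co inf by (intro finite_ordLess_infinite card_of_Well_order card_order_on_well_order_on)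
      (simp_all add: Field_card_of)
next
  case False
  have "|A i| \<le>o |I|" if "i \<in> I" for i
    using fin[OF that] False
    by (intro ordLess_imp_ordLeq finite_ordLess_infinite card_of_Well_order) (simp_all add: Field_card_of)
  then have "|\<Union>i\<in>I. A i| \<le>o |I|"
    by (intro card_of_UNION_ordLeq_infinite[OF False]) (simp_all add: card_of_refl ordIso_imp_ordLeq)
  then show ?thesis using I by (rule ordLeq_ordLess_trans)
qed

text \<open>
  The recursion runs along a well-ordering of \<open>'b\<close> of minimal length, so that fewer than
  \<open>|'b|\<close> elements have been chosen at each stage. A requirement \<open>T D b\<close> on the final set \<open>D\<close> was
  already in force when \<open>b\<close> was treated, because \<open>T\<close> is inherited by subsets.
\<close>

lemma transfinite_extension:
  fixes U :: "'p set" and T :: "'p set \<Rightarrow> 'b \<Rightarrow> bool"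
  assumes step: "\<And>D b. D \<subseteq> U \<Longrightarrow> pairwise P D \<Longrightarrow> |D| <o |UNIV :: 'b set| \<Longrightarrow> T D b \<Longrightarrow>
      \<exists>p\<in>U. R b p \<and> (\<forall>q\<in>D. P p q \<and> P q p)"
    and anti: "\<And>D D' b. D' \<subseteq> D \<Longrightarrow> T D b \<Longrightarrow> T D' b"
  obtains D where "D \<subseteq> U" "pairwise P D" "\<And>b. T D b \<Longrightarrow> \<exists>p\<in>D. R b p"
proof -
  let ?r = "|UNIV :: 'b set|"
  have wo: "wo_rel ?r" by (simp add: wo_rel_def card_of_Well_order)
  have wf: "wf (?r - Id)" by (rule wo_rel.WF[OF wo])
  have tot: "(b, c) \<in> ?r - Id \<or> b = c \<or> (c, b) \<in> ?r - Id" for b c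
    using wo_rel.TOTALS[OF wo] by (auto simp: Field_card_of)
  define ext where "ext D b p \<longleftrightarrow> p \<in> U \<and> R b p \<and> (\<forall>q\<in>D. P p q \<and> P q p)" for D b p
  define pick where "pick D b = (if \<exists>p. ext D b p then {SOME p. ext D b p} else {})" for D b
  define G where "G = wfrec (?r - Id) (\<lambda>G b. pick (\<Union>c\<in>{c. (c, b) \<in> ?r - Id}. G c) b)"
  define Below where "Below b = (\<Union>c\<in>{c. (c, b) \<in> ?r - Id}. G c)" for b
  have G: "G b = pick (Below b) b" for b
    unfolding Below_def by (subst def_wfrec[OF eq_reflection[OF G_def] wf]) (simp add: cut_apply)
  have G_ext: "ext (Below b) b p" if "p \<in> G b" for b p
    using that someI_ex[of "ext (Below b) b"] unfolding G pick_def by (auto split: if_splits)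
  have G_single: "p = q" if "p \<in> G b" "q \<in> G b" for b p q
    using that unfolding G pick_def by (auto split: if_splits)
  have sub: "\<Union>(range G) \<subseteq> U" using G_ext by (auto simp: ext_def)
  have below: "G c \<subseteq> Below b" if "(c, b) \<in> ?r - Id" for b c using that unfolding Below_def by blast
  have "P p q" if p: "p \<in> G b" and q: "q \<in> G c" and "p \<noteq> q" for p q b c
    using tot[of b c]
  proof (elim disjE)
    assume "(b, c) \<in> ?r - Id"
    then show ?thesis using below p G_ext[OF q] unfolding ext_def by blast
  next
    assume "b = c"
    then show ?thesis using p q that G_single by blast
  next
    assume "(c, b) \<in> ?r - Id"
    then show ?thesis using below q G_ext[OF p] unfolding ext_def by blast
  qed
  then have pw: "pairwise P (\<Union>(range G))" unfolding pairwise_def by blast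
  show ?thesis
  proof (rule that[OF sub pw])
    fix b assume T: "T (\<Union>(range G)) b"
    have sb: "Below b \<subseteq> \<Union>(range G)" unfolding Below_def by blast
    have "Below b \<subseteq> (\<lambda>c. SOME p. p \<in> G c) ` underS ?r b"
    proof
      fix p assume "p \<in> Below b"
      then obtain c where c: "(c, b) \<in> ?r - Id" "p \<in> G c" unfolding Below_def by blast
      then have "(SOME p. p \<in> G c) = p" using G_single by blast
      then show "p \<in> (\<lambda>c. SOME p. p \<in> G c) ` underS ?r b" using c by (force simp: underS_def)
    qed
    then have "|Below b| \<le>o |underS ?r b|" by (rule surj_imp_ordLeq)
    then have "|Below b| <o ?r"
      using card_of_underS[OF card_of_Card_order, of b UNIV] ordLeq_ordLess_trans
      by (auto simp: Field_card_of)
    then have "\<exists>p. ext (Below b) b p"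
      using step[of "Below b" b] sb sub pairwise_subset[OF pw sb] anti[OF sb T]
      unfolding ext_def by blast
    then have "\<exists>p. p \<in> G b" unfolding G pick_def by auto
    then show "\<exists>p\<in>\<Union>(range G). R b p" using G_ext unfolding ext_def by blast
  qed
qed

section \<open>The tree of positive sets\<close>

text \<open>
  The two consequences of \<open>\<kappa> = \<ss> = \<aa>\<^sub>*\<close> on which the construction rests.
\<close>

locale splitting_tree =
  fixes \<kappa> :: "'k rel" and e :: "'k \<Rightarrow> nat set"
  assumes card: "Card_order \<kappa>" and infinite_card: "infinite (Field \<kappa>)"
    and splits: "\<And>a. (\<And>n::nat. infinite (a n)) \<Longrightarrow>
      \<exists>\<xi>\<in>Field \<kappa>. \<forall>n. infinite (a n \<inter> e \<xi>) \<and> infinite (a n - e \<xi>)"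
    and extend: "\<And>F c. pairwise almost_disjoint F \<Longrightarrow> |F| <o \<kappa> \<Longrightarrow> c \<in> id_plus F \<Longrightarrow>
      \<exists>d\<subseteq>c. infinite d \<and> (\<forall>x\<in>F. almost_disjoint d x)"
begin

definition side :: "'k \<Rightarrow> bool \<Rightarrow> nat set" where
  "side \<xi> i = (if i then e \<xi> else - e \<xi>)"

text \<open>
  The minimum is meaningful for a positive \<open>b\<close> and an almost disjoint \<open>A\<close>, by
  \<open>positive_splits\<close> below.
\<close>

definition split :: "nat set set \<Rightarrow> nat set \<Rightarrow> 'k" where
  "split A b = wo_rel.minim \<kappa> {\<xi>\<in>Field \<kappa>. \<forall>i. b \<inter> side \<xi> i \<in> id_plus A}"

text \<open>
  Below \<open>split A b\<close> exactly one side of \<open>e \<zeta>\<close> meets \<open>b\<close> in a positive set; the branch records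
  which one.
\<close>

definition branch :: "nat set set \<Rightarrow> nat set \<Rightarrow> 'k \<rightharpoonup> bool" where
  "branch A b \<zeta> = (if \<zeta> \<in> underS \<kappa> (split A b) then Some (b \<inter> side \<zeta> True \<in> id_plus A) else None)"

lemma wo: "wo_rel \<kappa>"
  using card by (simp add: wo_rel_def card_order_on_well_order_on)

lemma side_Compl: "x - side \<xi> i = x \<inter> side \<xi> (\<not> i)"
  by (auto simp: side_def)

lemma underS_subset_iff:
  assumes "\<xi> \<in> Field \<kappa>" "\<eta> \<in> Field \<kappa>"
  shows "underS \<kappa> \<xi> \<subseteq> underS \<kappa> \<eta> \<longleftrightarrow> (\<xi>, \<eta>) \<in> \<kappa>"
proof
  assume sub: "underS \<kappa> \<xi> \<subseteq> underS \<kappa> \<eta>"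
  show "(\<xi>, \<eta>) \<in> \<kappa>"
  proof (rule ccontr)
    assume n: "(\<xi>, \<eta>) \<notin> \<kappa>"
    then have "(\<eta>, \<xi>) \<in> \<kappa>" "\<eta> \<noteq> \<xi>"
      using wo_rel.TOTALS[OF wo] assms by blast+
    then have "\<eta> \<in> underS \<kappa> \<xi>" by (simp add: underS_def)
    then show False using sub by (auto simp: underS_def)
  qed
next
  assume "(\<xi>, \<eta>) \<in> \<kappa>"
  then show "underS \<kappa> \<xi> \<subseteq> underS \<kappa> \<eta>"
    using underS_incr[OF wo_rel.TRANS[OF wo] wo_rel.ANTISYM[OF wo]] by blast
qed

text \<open>
  Either split infinitely many infinite traces of members on \<open>b\<close> simultaneously, or split an
  infinite subset of \<open>b\<close> that is almost disjoint from all members; in both cases the two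
  pieces of \<open>b\<close> stay positive for the same reason as \<open>b\<close> was.
\<close>

lemma positive_splits:
  assumes AD: "pairwise almost_disjoint A" and b: "b \<in> id_plus A"
  shows "\<exists>\<xi>\<in>Field \<kappa>. \<forall>i. b \<inter> side \<xi> i \<in> id_plus A"
  using b
proof (cases rule: id_plus_cases)
  case meets
  obtain f :: "nat \<Rightarrow> nat set" where f: "inj f" "range f \<subseteq> {x\<in>A. infinite (b \<inter> x)}"
    using infinite_countable_subset[OF meets] by blast
  then have "\<And>n. infinite (b \<inter> f n)" by blast
  then obtain \<xi> where \<xi>: "\<xi> \<in> Field \<kappa>"
    "\<And>n. infinite (b \<inter> f n \<inter> e \<xi>) \<and> infinite (b \<inter> f n - e \<xi>)"
    using splits[of "\<lambda>n. b \<inter> f n"] by blast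
  have "infinite (b \<inter> side \<xi> i \<inter> f n)" for i n
  proof -
    have "b \<inter> side \<xi> i \<inter> f n = (if i then b \<inter> f n \<inter> e \<xi> else b \<inter> f n - e \<xi>)"
      unfolding side_def by auto
    then show ?thesis using \<xi>(2)[of n] by (cases i) auto
  qed
  then have "range f \<subseteq> {x\<in>A. infinite (b \<inter> side \<xi> i \<inter> x)}" for i using f(2) by blast
  then have "b \<inter> side \<xi> i \<in> id_plus A" for i
    using id_plus_if_infinite_meets[OF AD] range_inj_infinite[OF f(1)] by (meson finite_subset)
  then show ?thesis using \<xi>(1) by blast
next
  case (disjoint Y)
  obtain \<xi> where \<xi>: "\<xi> \<in> Field \<kappa>" "infinite (Y \<inter> e \<xi>) \<and> infinite (Y - e \<xi>)"
    using splits[of "\<lambda>_. Y"] disjoint(2) by blast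
  have "b \<inter> side \<xi> i \<in> id_plus A" for i
  proof (rule id_plus_if_disjoint)
    show "Y \<inter> side \<xi> i \<subseteq> b \<inter> side \<xi> i" using disjoint(1) by blast
    show "infinite (Y \<inter> side \<xi> i)" using \<xi>(2) by (cases i) (simp_all add: side_def Diff_eq)
    show "almost_disjoint (Y \<inter> side \<xi> i) x" if "x \<in> A" for x
      using disjoint(3)[OF that] unfolding almost_disjoint_def by (rule rev_finite_subset) auto
  qed
  then show ?thesis using \<xi>(1) by blast
qed

lemma split_in:
  assumes "pairwise almost_disjoint A" "b \<in> id_plus A"
  shows "split A b \<in> Field \<kappa>" and "b \<inter> side (split A b) i \<in> id_plus A"
proof -
  have "split A b \<in> {\<xi>\<in>Field \<kappa>. \<forall>i. b \<inter> side \<xi> i \<in> id_plus A}"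
    unfolding split_def using positive_splits[OF assms] by (intro wo_rel.minim_in[OF wo]) auto
  then show "split A b \<in> Field \<kappa>" and "b \<inter> side (split A b) i \<in> id_plus A" by auto
qed

lemma split_least:
  assumes "\<xi> \<in> Field \<kappa>" "\<And>i. b \<inter> side \<xi> i \<in> id_plus A"
  shows "(split A b, \<xi>) \<in> \<kappa>"
  unfolding split_def using assms by (intro wo_rel.minim_least[OF wo]) auto

lemma dom_branch: "dom (branch A b) = underS \<kappa> (split A b)"
  by (auto simp: branch_def split: if_splits)

lemma branch_Some:
  assumes b: "b \<in> id_plus A" and br: "branch A b \<zeta> = Some i"
  shows "b \<inter> side \<zeta> i \<in> id_plus A" and "b \<inter> side \<zeta> (\<not> i) \<notin> id_plus A"
proof -
  have \<zeta>: "\<zeta> \<in> underS \<kappa> (split A b)" and i: "i \<longleftrightarrow> b \<inter> side \<zeta> True \<in> id_plus A"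
    using br by (auto simp: branch_def split: if_splits)
  have "\<zeta> \<in> Field \<kappa>" "(\<zeta>, split A b) \<in> \<kappa>" "\<zeta> \<noteq> split A b"
    using \<zeta> by (auto simp: underS_def Field_def)
  then have "\<not> (\<forall>j. b \<inter> side \<zeta> j \<in> id_plus A)"
    using split_least[of \<zeta> b A] wo_rel.ANTISYM[OF wo] by (auto simp: antisym_def)
  moreover have "b \<inter> side \<zeta> True \<in> id_plus A \<or> b \<inter> side \<zeta> False \<in> id_plus A"
    using id_plus_half[OF b, of "side \<zeta> True"] by (simp add: side_Compl)
  ultimately show "b \<inter> side \<zeta> i \<in> id_plus A" and "b \<inter> side \<zeta> (\<not> i) \<notin> id_plus A"
    using i by (cases i; simp; metis (full_types))+
qed

text \<open>
  A set that splits \<open>c\<close> also splits the larger \<open>b\<close>, so the splitting index can only increase. It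
  does increase, because one side of \<open>e (split A b)\<close> meets \<open>c\<close> only in a finite set.
\<close>

lemma branch_below:
  assumes AD: "pairwise almost_disjoint A" and b: "b \<in> id_plus A"
    and c: "c \<in> id_plus A" "c \<subseteq>* b \<inter> side (split A b) i"
  shows "branch A c (split A b) = Some i"
proof -
  let ?\<xi> = "split A b" and ?\<eta> = "split A c"
  have mono: "b \<inter> side \<zeta> j \<in> id_plus A" if "c \<inter> side \<zeta> j \<in> id_plus A" for \<zeta> j
    using that
  proof (rule id_plus_almost_mono)
    show "c \<inter> side \<zeta> j \<subseteq>* b \<inter> side \<zeta> j"
      using c(2) unfolding almost_subset_def by (rule rev_finite_subset) auto
  qed
  have "(?\<xi>, ?\<eta>) \<in> \<kappa>"
    by (intro split_least split_in(1)[OF AD c(1)] mono split_in(2)[OF AD c(1)])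
  moreover have fin: "finite (c \<inter> side ?\<xi> (\<not> i))"
    using c(2) unfolding almost_subset_def by (rule rev_finite_subset) (auto simp: side_def)
  then have no: "c \<inter> side ?\<xi> (\<not> i) \<notin> id_plus A" using id_plus_infinite by blast
  then have "?\<xi> \<noteq> ?\<eta>" using split_in(2)[OF AD c(1), of "\<not> i"] by metis
  ultimately have "?\<xi> \<in> underS \<kappa> ?\<eta>" by (simp add: underS_def)
  then obtain j where j: "branch A c ?\<xi> = Some j" by (simp add: branch_def)
  then have "j = i" using branch_Some(1)[OF c(1) j] no by (cases i; cases j) auto
  then show ?thesis using j by simp
qed

text \<open>
  A node is a candidate member together with its label; the label is a 0-1 sequence of length
  \<open>\<eta> < \<kappa>\<close>, coded as a partial function.
\<close>

definition nodes :: "nat set set \<Rightarrow> (nat set \<times> ('k \<rightharpoonup> bool)) set" where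
  "nodes J = {p. fst p \<in> J \<and> (\<exists>\<eta>\<in>Field \<kappa>. dom (snd p) = underS \<kappa> \<eta>) \<and>
     (\<forall>\<zeta> i. snd p \<zeta> = Some i \<longrightarrow> fst p \<subseteq>* side \<zeta> i)}"

definition apart :: "nat set \<times> ('k \<rightharpoonup> bool) \<Rightarrow> nat set \<times> ('k \<rightharpoonup> bool) \<Rightarrow> bool" where
  "apart p q \<longleftrightarrow> almost_disjoint (fst p) (fst q) \<and> snd p \<noteq> snd q"

lemma pairwise_apart_fst:
  assumes "pairwise apart D"
  shows "pairwise almost_disjoint (fst ` D)"
proof (rule pairwise_imageI)
  fix p q assume "p \<in> D" "q \<in> D" "p \<noteq> q"
  then show "almost_disjoint (fst p) (fst q)"
    using assms unfolding pairwise_def apart_def by blast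
qed

text \<open>
  A subset \<open>X\<close> of \<open>\<omega>\<close> prescribes which of the two positive pieces to keep at each step of the
  iterated splitting, and \<open>p X\<close> is a positive pseudointersection of the sets obtained. If \<open>X\<close>
  and \<open>Y\<close> first differ at \<open>n\<close>, the branches of \<open>p X\<close> and \<open>p Y\<close> disagree at the splitting index of
  their common \<open>n\<close>-th set, so no \<open>\<sigma>\<close> extends both.
\<close>

lemma perfect_tree:
  assumes AD: "pairwise almost_disjoint A" and b: "b \<in> id_plus A"
  shows "\<exists>p :: nat set \<Rightarrow> nat set. (\<forall>X. p X \<in> id_plus A \<and> p X \<subseteq> b) \<and>
    (\<forall>X Y \<sigma>. branch A (p X) \<subseteq>\<^sub>m \<sigma> \<and> branch A (p Y) \<subseteq>\<^sub>m \<sigma> \<longrightarrow> X = Y)"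
proof -
  define B where "B X = rec_nat b (\<lambda>n c. c \<inter> side (split A c) (n \<in> X))" for X :: "nat set"
  have B0: "B X 0 = b" and B_Suc: "B X (Suc n) = B X n \<inter> side (split A (B X n)) (n \<in> X)" for X n
    by (simp_all add: B_def)
  have pos: "B X n \<in> id_plus A" for X n
    by (induction n) (simp_all add: B0 B_Suc b split_in(2)[OF AD])
  have "\<exists>p. p \<in> id_plus A \<and> p \<subseteq> b \<and> (\<forall>n. p \<subseteq>* B X n)" for X
  proof -
    obtain p where "p \<in> id_plus A" "p \<subseteq> B X 0" "\<And>n. p \<subseteq>* B X n"
      using id_plus_pseudointersection[OF AD, of "B X"] pos B_Suc by (metis inf_le1)
    then show ?thesis using B0 by blast
  qed
  then obtain p where p: "\<And>X. p X \<in> id_plus A" "\<And>X. p X \<subseteq> b" "\<And>X n. p X \<subseteq>* B X n"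
    by metis
  have br: "branch A (p X) (split A (B X n)) = Some (n \<in> X)" for X n
    using branch_below[OF AD pos p(1)] p(3)[of X "Suc n"] by (simp add: B_Suc)
  have "X = Y" if le: "branch A (p X) \<subseteq>\<^sub>m \<sigma>" "branch A (p Y) \<subseteq>\<^sub>m \<sigma>" for X Y \<sigma>
  proof -
    have "B X n = B Y n \<and> (\<forall>m<n. m \<in> X \<longleftrightarrow> m \<in> Y)" for n
    proof (induction n)
      case 0
      show ?case by (simp add: B0)
    next
      case (Suc n)
      have "\<sigma> (split A (B X n)) = Some (n \<in> X)" "\<sigma> (split A (B Y n)) = Some (n \<in> Y)"
        using le br[of X n] br[of Y n] unfolding map_le_def by (metis domI)+
      then have "n \<in> X \<longleftrightarrow> n \<in> Y" using Suc by simp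
      then show ?case using Suc by (auto simp: B_Suc less_Suc_eq)
    qed
    then show ?thesis by blast
  qed
  then show ?thesis using p(1,2) by (intro exI[of _ p]) blast
qed

section \<open>Adding one member\<close>

text \<open>
  The new member is found inside a positive \<open>c \<subseteq> b\<close> whose branch \<open>\<tau>\<close> is not extended by any
  earlier label. It has to avoid two kinds of members explicitly: those with a label below \<open>\<tau>\<close>, which
  are fewer than \<open>\<kappa>\<close> since such a label is determined by its length, and for each \<open>\<zeta>\<close> in the
  domain of \<open>\<tau>\<close> finitely many that almost cover the part of \<open>c\<close> on the wrong side of \<open>e \<zeta>\<close>.
  Avoiding the latter puts the new member almost inside the correct sides, and this makes it
  almost disjoint from every member with an incompatible label.
\<close>

lemma extension_step:
  fixes D :: "(nat set \<times> ('k \<rightharpoonup> bool)) set"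
  assumes J: "dense_family J" and D: "D \<subseteq> nodes J" "pairwise apart D"
    and small: "|D| <o |UNIV :: nat set set|" and b: "b \<in> id_plus (fst ` D)"
  shows "\<exists>p\<in>nodes J. fst p \<subseteq> b \<and> (\<forall>q\<in>D. apart p q \<and> apart q p)"
proof -
  let ?A = "fst ` D"
  have AD: "pairwise almost_disjoint ?A" by (rule pairwise_apart_fst[OF D(2)])
  obtain p :: "nat set \<Rightarrow> nat set" where p: "\<forall>X. p X \<in> id_plus ?A \<and> p X \<subseteq> b"
    and p_inj: "\<forall>X Y \<sigma>. branch ?A (p X) \<subseteq>\<^sub>m \<sigma> \<and> branch ?A (p Y) \<subseteq>\<^sub>m \<sigma> \<longrightarrow> X = Y"
    using perfect_tree[OF AD b] by (elim exE conjE)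
  \<comment> \<open>An earlier label extends the branch of at most one \<open>p X\<close>, and there are fewer labels
     than sets \<open>X\<close>.\<close>
  have "\<exists>X. \<forall>q\<in>D. \<not> branch ?A (p X) \<subseteq>\<^sub>m snd q"
  proof (rule ccontr)
    assume "\<not> ?thesis"
    then obtain h where h: "\<And>X. h X \<in> D" "\<And>X. branch ?A (p X) \<subseteq>\<^sub>m snd (h X)" by metis
    have "inj h" using p_inj h(2) by (intro injI) metis
    then have "|UNIV :: nat set set| \<le>o |D|" using h(1) card_of_ordLeq[of UNIV D] by blast
    then show False using small not_ordLess_ordLeq by blast
  qed
  then obtain X where X: "\<And>q. q \<in> D \<Longrightarrow> \<not> branch ?A (p X) \<subseteq>\<^sub>m snd q" by blast
  define c where "c = p X"
  define \<tau> where "\<tau> = branch ?A c"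
  define \<xi> where "\<xi> = split ?A c"
  have c: "c \<in> id_plus ?A" "c \<subseteq> b" using p unfolding c_def by blast+
  have \<xi>: "\<xi> \<in> Field \<kappa>" unfolding \<xi>_def by (rule split_in(1)[OF AD c(1)])
  have dom_\<tau>: "dom \<tau> = underS \<kappa> \<xi>" unfolding \<tau>_def \<xi>_def by (rule dom_branch)
  have not_above: "\<not> \<tau> \<subseteq>\<^sub>m snd q" if "q \<in> D" for q
    using X[OF that] unfolding \<tau>_def c_def .
  \<comment> \<open>For each \<open>\<zeta>\<close> in the domain of \<open>\<tau>\<close>, the part of \<open>c\<close> on the wrong side lies in the ideal.\<close>
  have "\<exists>F. finite F \<and> (\<forall>i. \<tau> \<zeta> = Some i \<longrightarrow>
      F \<subseteq> ?A \<and> finite (c \<inter> side \<zeta> (\<not> i) - \<Union>F))" for \<zeta>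
  proof (cases "\<tau> \<zeta>")
    case (Some i)
    then have "c \<inter> side \<zeta> (\<not> i) \<notin> id_plus ?A"
      using branch_Some(2)[OF c(1)] unfolding \<tau>_def by blast
    then show ?thesis using Some unfolding id_plus_iff by auto
  qed auto
  then obtain F where F: "\<And>\<zeta>. finite (F \<zeta>)" "\<And>\<zeta> i. \<tau> \<zeta> = Some i \<Longrightarrow> F \<zeta> \<subseteq> ?A"
    "\<And>\<zeta> i. \<tau> \<zeta> = Some i \<Longrightarrow> finite (c \<inter> side \<zeta> (\<not> i) - \<Union>(F \<zeta>))"
    by metis
  define Q where "Q = {q\<in>D. snd q \<subseteq>\<^sub>m \<tau>}"
  have "\<exists>\<eta>\<in>Field \<kappa>. dom (snd q) = underS \<kappa> \<eta>" if "q \<in> D" for q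
    using subsetD[OF D(1) that] unfolding nodes_def by blast
  then obtain \<eta> where \<eta>: "\<And>q. q \<in> D \<Longrightarrow> \<eta> q \<in> Field \<kappa>" "\<And>q. q \<in> D \<Longrightarrow> dom (snd q) = underS \<kappa> (\<eta> q)"
    by metis
  \<comment> \<open>A restriction of \<open>\<tau>\<close> is determined by its length, and these lengths are less than \<open>\<xi>\<close>.\<close>
  have "inj_on \<eta> Q"
  proof (rule inj_onI)
    fix q r assume q: "q \<in> Q" "r \<in> Q" "\<eta> q = \<eta> r"
    then have "dom (snd q) = dom (snd r)" using \<eta>(2) unfolding Q_def by auto
    moreover have "snd q \<subseteq>\<^sub>m \<tau>" "snd r \<subseteq>\<^sub>m \<tau>" using q unfolding Q_def by blast+
    ultimately have "snd q = snd r"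
      unfolding map_le_def by (intro ext) (metis domIff)
    then show "q = r" using D(2) q unfolding Q_def pairwise_def apart_def by blast
  qed
  moreover have "\<eta> ` Q \<subseteq> underS \<kappa> \<xi>"
  proof
    fix x assume "x \<in> \<eta> ` Q"
    then obtain q where q: "x = \<eta> q" "q \<in> D" "snd q \<subseteq>\<^sub>m \<tau>" unfolding Q_def by blast
    have "underS \<kappa> (\<eta> q) \<subseteq> underS \<kappa> \<xi>"
      using map_le_implies_dom_le[OF q(3)] \<eta>(2)[OF q(2)] dom_\<tau> by simp
    then have "(\<eta> q, \<xi>) \<in> \<kappa>" using underS_subset_iff \<eta>(1)[OF q(2)] \<xi> by blast
    moreover have "\<eta> q \<noteq> \<xi>"
    proof
      assume "\<eta> q = \<xi>"
      then have "dom (snd q) = dom \<tau>" using \<eta>(2)[OF q(2)] dom_\<tau> by simp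
      then have "\<tau> \<subseteq>\<^sub>m snd q" using q(3) unfolding map_le_def by metis
      then show False using not_above[OF q(2)] by blast
    qed
    ultimately show "x \<in> underS \<kappa> \<xi>" using q(1) by (simp add: underS_def)
  qed
  ultimately have "|Q| \<le>o |underS \<kappa> \<xi>|" using card_of_ordLeq[of Q] by blast
  then have "|Q| <o \<kappa>" using card_of_underS[OF card \<xi>] by (rule ordLeq_ordLess_trans)
  with card_of_image have "|fst ` Q| <o \<kappa>" by (rule ordLeq_ordLess_trans)
  moreover have "|\<Union>\<zeta>\<in>dom \<tau>. F \<zeta>| <o \<kappa>"
    unfolding dom_\<tau> by (rule card_of_UN_finite_ordLess[OF card infinite_card card_of_underS[OF card \<xi>] F(1)])
  ultimately have few: "|fst ` Q \<union> (\<Union>\<zeta>\<in>dom \<tau>. F \<zeta>)| <o \<kappa>"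
    by (rule card_of_Un_ordLess_infinite_Field[OF infinite_card card])
  have sub: "fst ` Q \<union> (\<Union>\<zeta>\<in>dom \<tau>. F \<zeta>) \<subseteq> ?A" using F(2) unfolding Q_def by blast
  obtain d where d: "d \<subseteq> c" "infinite d"
    "\<forall>x\<in>fst ` Q \<union> (\<Union>\<zeta>\<in>dom \<tau>. F \<zeta>). almost_disjoint d x"
    using extend[OF pairwise_subset[OF AD sub] few id_plus_antimono[OF sub c(1)]] by (elim exE conjE)
  have "d \<in> [UNIV]\<^sup>\<omega>" using d(2) by (simp add: ctbl_inf_subsets_def)
  then obtain a where a: "a \<in> J" "a \<subseteq> d" using J unfolding dense_family_def by blast
  have along: "a \<subseteq>* side \<zeta> i" if \<zeta>: "\<tau> \<zeta> = Some i" for \<zeta> i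
  proof -
    have "a - side \<zeta> i \<subseteq> (c \<inter> side \<zeta> (\<not> i) - \<Union>(F \<zeta>)) \<union> (\<Union>x\<in>F \<zeta>. d \<inter> x)"
      using a(2) d(1) unfolding side_Compl by blast
    moreover have "finite (\<Union>x\<in>F \<zeta>. d \<inter> x)"
    proof (rule finite_UN_I[OF F(1)])
      fix x assume "x \<in> F \<zeta>"
      then show "finite (d \<inter> x)" using d(3) \<zeta> unfolding almost_disjoint_def by blast
    qed
    ultimately show ?thesis using F(3)[OF \<zeta>] unfolding almost_subset_def
      by (meson finite_UnI finite_subset)
  qed
  then have node: "(a, \<tau>) \<in> nodes J" using a(1) \<xi> dom_\<tau> unfolding nodes_def by auto
  have ap: "almost_disjoint a (fst q)" if q: "q \<in> D" for q
  proof (cases "snd q \<subseteq>\<^sub>m \<tau>")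
    case True
    then have "fst q \<in> fst ` Q" using q unfolding Q_def by blast
    then have "finite (d \<inter> fst q)" using d(3) unfolding almost_disjoint_def by blast
    then show ?thesis unfolding almost_disjoint_def by (rule rev_finite_subset) (use a(2) in blast)
  next
    case False
    \<comment> \<open>The domains are comparable and neither label extends the other, so they disagree at a
       common point.\<close>
    have "dom \<tau> \<subseteq> dom (snd q) \<or> dom (snd q) \<subseteq> dom \<tau>"
      unfolding dom_\<tau> \<eta>(2)[OF q] underS_subset_iff[OF \<xi> \<eta>(1)[OF q]] underS_subset_iff[OF \<eta>(1)[OF q] \<xi>]
      using wo_rel.TOTALS[OF wo] \<xi> \<eta>(1)[OF q] by blast
    moreover obtain \<zeta>1 \<zeta>2 where "\<zeta>1 \<in> dom \<tau>" "\<tau> \<zeta>1 \<noteq> snd q \<zeta>1"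
      and "\<zeta>2 \<in> dom (snd q)" "snd q \<zeta>2 \<noteq> \<tau> \<zeta>2"
      using False not_above[OF q] unfolding map_le_def by blast
    ultimately have "\<exists>\<zeta>\<in>{\<zeta>1, \<zeta>2}. \<zeta> \<in> dom \<tau> \<and> \<zeta> \<in> dom (snd q) \<and> \<tau> \<zeta> \<noteq> snd q \<zeta>"
      by (elim disjE) (simp_all add: subset_iff eq_commute)
    then obtain \<zeta> where "\<zeta> \<in> dom \<tau>" "\<zeta> \<in> dom (snd q)" "\<tau> \<zeta> \<noteq> snd q \<zeta>" by blast
    then obtain i where i: "\<tau> \<zeta> = Some i" "snd q \<zeta> = Some (\<not> i)" by auto
    have "fst q \<subseteq>* side \<zeta> (\<not> i)" using subsetD[OF D(1) q] i(2) unfolding nodes_def by blast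
    moreover have "a \<inter> fst q \<subseteq> (a - side \<zeta> i) \<union> (fst q - side \<zeta> (\<not> i))"
      by (auto simp: side_def)
    ultimately show ?thesis using along[OF i(1)] unfolding almost_disjoint_def almost_subset_def
      by (meson finite_UnI finite_subset)
  qed
  have "apart (a, \<tau>) q \<and> apart q (a, \<tau>)" if "q \<in> D" for q
  proof -
    have "snd q \<noteq> \<tau>" using not_above[OF that] by auto
    then show ?thesis using ap[OF that] by (auto simp: apart_def almost_disjoint_def Int_commute)
  qed
  moreover have "a \<subseteq> b" using a(2) d(1) c(2) by blast
  ultimately show ?thesis using node by (intro bexI[of _ "(a, \<tau>)"]) auto
qed

lemma family_meeting_positive_sets:
  assumes J: "dense_family J"
  obtains A where "A \<subseteq> J" "pairwise almost_disjoint A" "\<And>b. b \<in> id_plus A \<Longrightarrow> \<exists>a\<in>A. a \<subseteq> b"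
proof -
  obtain D where D: "D \<subseteq> nodes J" "pairwise apart D"
    and meet: "\<And>b. b \<in> id_plus (fst ` D) \<Longrightarrow> \<exists>p\<in>D. fst p \<subseteq> b"
  proof (rule transfinite_extension[of "nodes J" apart "\<lambda>D b. b \<in> id_plus (fst ` D)" "\<lambda>b p. fst p \<subseteq> b"])
    show "\<exists>p\<in>nodes J. fst p \<subseteq> b \<and> (\<forall>q\<in>D. apart p q \<and> apart q p)"
      if "D \<subseteq> nodes J" "pairwise apart D" "|D| <o |UNIV :: nat set set|" "b \<in> id_plus (fst ` D)" for D b
      using extension_step[OF J that] .
    show "b \<in> id_plus (fst ` D')" if "D' \<subseteq> D" "b \<in> id_plus (fst ` D)"
      for D D' :: "(nat set \<times> ('k \<rightharpoonup> bool)) set" and b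
      using id_plus_antimono[OF image_mono[OF that(1)] that(2)] .
  qed auto
  show ?thesis
  proof (rule that)
    show "fst ` D \<subseteq> J" using D(1) by (auto simp: nodes_def)
    show "pairwise almost_disjoint (fst ` D)" by (rule pairwise_apart_fst[OF D(2)])
    show "\<exists>a\<in>fst ` D. a \<subseteq> b" if "b \<in> id_plus (fst ` D)" for b using meet[OF that] by blast
  qed
qed

end

section \<open>Saturated MAD families\<close>

text \<open>
  An infinite set almost disjoint from all members is positive, so it would contain a member.
\<close>

lemma saturated_MAD_if_meets_positive_sets:
  assumes A: "A \<subseteq> [UNIV]\<^sup>\<omega>" "infinite A" "pairwise almost_disjoint A"
    and meet: "\<And>b. b \<in> id_plus A \<Longrightarrow> \<exists>a\<in>A. a \<subseteq> b"
  shows "saturated_MAD A"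
proof -
  have "B = A" if B: "AD B" "A \<subseteq> B" for B
  proof (rule ccontr)
    assume "B \<noteq> A"
    then obtain b where b: "b \<in> B" "b \<notin> A" using B(2) by blast
    have ad: "almost_disjoint b x" if "x \<in> A" for x
    proof -
      have "x \<in> B" "b \<noteq> x" using that B(2) b(2) by auto
      then show ?thesis using B(1) b(1) unfolding AD_def pairwise_def by blast
    qed
    have "infinite b" using B(1) b(1) unfolding AD_def ctbl_inf_subsets_def by blast
    then have "b \<in> id_plus A" using id_plus_if_disjoint[of b b A] ad by blast
    then obtain a where a: "a \<in> A" "a \<subseteq> b" using meet by blast
    then have "finite a" using ad[OF a(1)] by (simp add: almost_disjoint_def Int_absorb1)
    then show False using a(1) A(1) by (auto simp: ctbl_inf_subsets_def)
  qed
  moreover have "\<exists>a\<in>A. a \<subseteq>* b" if b: "b \<in> id_plus A" for b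
  proof -
    obtain a where "a \<in> A" "a \<subseteq> b" using meet[OF b] by blast
    then have "a \<subseteq>* b" by (simp add: almost_subset_def Diff_eq_empty_iff[THEN iffD2])
    with \<open>a \<in> A\<close> show ?thesis ..
  qed
  moreover have "AD A" using A unfolding AD_def by blast
  ultimately show ?thesis unfolding saturated_MAD_def MAD_def by blast
qed

text \<open>
  Fix a partition of \<open>\<omega>\<close> into infinitely many infinite sets. The sets in \<open>J\<close> with an infinite
  trace on at most one part are still dense, and a finite number of them leaves some part
  almost untouched. This keeps the family constructed below from being finite.
\<close>

lemma dense_family_thin:
  assumes "dense_family J"
  obtains J' where "dense_family J'" "J' \<subseteq> J"
    "\<And>F. finite F \<Longrightarrow> F \<subseteq> J' \<Longrightarrow> \<exists>d. infinite d \<and> (\<forall>a\<in>F. almost_disjoint d a)"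
proof -
  define P where "P n = {m. fst (prod_decode m) = n}" for n
  have P_inf: "infinite (P n)" for n
  proof -
    have "range (\<lambda>k. prod_encode (n, k)) \<subseteq> P n" by (auto simp: P_def)
    moreover have "inj (\<lambda>k. prod_encode (n, k))" by (rule injI) simp
    ultimately show ?thesis by (meson infinite_super range_inj_infinite)
  qed
  define J' where "J' = {a\<in>J. \<exists>k. \<forall>n. n \<noteq> k \<longrightarrow> almost_disjoint (P n) a}"
  have "\<exists>a\<in>J'. a \<subseteq> b" if b: "b \<in> [UNIV]\<^sup>\<omega>" for b
  proof (cases "\<exists>k. infinite (b \<inter> P k)")
    case True
    then obtain k where "infinite (b \<inter> P k)" by blast
    then obtain a where a: "a \<in> J" "a \<subseteq> b \<inter> P k"
      using assms unfolding dense_family_def ctbl_inf_subsets_def by blast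
    then have "P n \<inter> a = {}" if "n \<noteq> k" for n using that unfolding P_def by blast
    then have "\<forall>n. n \<noteq> k \<longrightarrow> almost_disjoint (P n) a" by (simp add: almost_disjoint_def)
    then show ?thesis using a unfolding J'_def by blast
  next
    case False
    obtain a where a: "a \<in> J" "a \<subseteq> b" using assms b unfolding dense_family_def by blast
    then have "finite (P n \<inter> a)" for n
      using False by (metis Int_commute Int_mono finite_subset subset_refl)
    then show ?thesis using a unfolding J'_def almost_disjoint_def by blast
  qed
  then have "dense_family J'" using assms unfolding dense_family_def J'_def by blast
  moreover have "\<exists>d. infinite d \<and> (\<forall>a\<in>F. almost_disjoint d a)" if F: "finite F" "F \<subseteq> J'" for F
  proof -
    have "\<forall>a\<in>F. \<exists>k. \<forall>n. n \<noteq> k \<longrightarrow> almost_disjoint (P n) a"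
      using F(2) unfolding J'_def by blast
    from bchoice[OF this] obtain k
      where k: "\<forall>a\<in>F. \<forall>n. n \<noteq> k a \<longrightarrow> almost_disjoint (P n) a" ..
    obtain n where "n \<notin> k ` F" using F(1) by (meson ex_new_if_finite finite_imageI infinite_UNIV_nat)
    then have "\<forall>a\<in>F. almost_disjoint (P n) a" using k by blast
    then show ?thesis using P_inf[of n] by blast
  qed
  moreover have "J' \<subseteq> J" unfolding J'_def by blast
  ultimately show ?thesis by (intro that[of J'])
qed

text \<open>
  If the family were finite, the thinness of \<open>J'\<close> would provide an infinite set almost disjoint
  from all members; this set is positive, hence contains a member, a contradiction.
\<close>

lemma saturated_MAD_in_dense_family:
  fixes \<kappa> :: "'k rel"
  assumes s: "is_splitting_number \<kappa>" and star: "is_a_star \<kappa>" and J: "dense_family J"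
  shows "\<exists>A. saturated_MAD A \<and> A \<subseteq> J"
proof -
  obtain e :: "'k \<Rightarrow> nat set" where e: "\<And>a. (\<And>n::nat. infinite (a n)) \<Longrightarrow>
       \<exists>\<xi>\<in>Field \<kappa>. \<forall>n. infinite (a n \<inter> e \<xi>) \<and> infinite (a n - e \<xi>)"
    using omega_splitting_sequence[OF s star] by metis
  interpret splitting_tree \<kappa> e
  proof
    show "Card_order \<kappa>" using star by (simp add: is_a_star_def)
    show "infinite (Field \<kappa>)" by (rule a_star_infinite[OF star])
    show "\<exists>\<xi>\<in>Field \<kappa>. \<forall>n. infinite (a n \<inter> e \<xi>) \<and> infinite (a n - e \<xi>)"
      if "\<And>n::nat. infinite (a n)" for a using e[of a] that .
    show "\<exists>d\<subseteq>c. infinite d \<and> (\<forall>x\<in>F. almost_disjoint d x)"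
      if "pairwise almost_disjoint F" "|F| <o \<kappa>" "c \<in> id_plus F" for F c
      using a_star_extend[OF star that] by metis
  qed
  obtain J' where J': "dense_family J'" "J' \<subseteq> J"
    and thin: "\<And>F. finite F \<Longrightarrow> F \<subseteq> J' \<Longrightarrow> \<exists>d. infinite d \<and> (\<forall>a\<in>F. almost_disjoint d a)"
    using dense_family_thin[OF J] by metis
  obtain A where A: "A \<subseteq> J'" "pairwise almost_disjoint A"
    and meet: "\<And>b. b \<in> id_plus A \<Longrightarrow> \<exists>a\<in>A. a \<subseteq> b"
    using family_meeting_positive_sets[OF J'(1)] by metis
  have A_inf: "A \<subseteq> [UNIV]\<^sup>\<omega>" using A(1) J'(1) unfolding dense_family_def by blast
  have "infinite A"
  proof
    assume "finite A"
    from thin[OF this A(1)] obtain d where d: "infinite d" "\<And>a. a \<in> A \<Longrightarrow> almost_disjoint d a"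
      by blast
    then have "d \<in> id_plus A" using id_plus_if_disjoint[of d d A] by blast
    then obtain a where a: "a \<in> A" "a \<subseteq> d" using meet by blast
    then have "finite a" using d(2)[OF a(1)] by (simp add: almost_disjoint_def Int_absorb1)
    then show False using a(1) A_inf by (auto simp: ctbl_inf_subsets_def)
  qed
  then have "saturated_MAD A"
    using A_inf A(2) meet by (intro saturated_MAD_if_meets_positive_sets)
  then show ?thesis using A(1) J'(2) by blast
qed

theorem theorem2p1:
  fixes \<kappa> :: "'k rel"
  assumes "is_splitting_number \<kappa>" and "is_a_star \<kappa>"
  shows "(is_cf_ctbl \<kappa> \<kappa> \<longrightarrow> (\<exists>\<A>. saturated_MAD \<A>)) \<and>
         (is_U \<kappa> \<kappa> \<longrightarrow>
           (\<forall>J. dense_family J \<longrightarrow> (\<exists>\<A>. saturated_MAD \<A> \<and> \<A> \<subseteq> J)))"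
proof -
  have "dense_family [UNIV]\<^sup>\<omega>" unfolding dense_family_def by blast
  then show ?thesis using saturated_MAD_in_dense_family[OF assms] by blast
qed

end
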